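(* Let $n\in\mathbb{N}$, let $K\subset\mathbb{Z}^n_+$ be an arbitrary admissible finite set, and let $\mathcal{K}=K+K$. Let real numbers (prescribed moments) $\mathcal{S}=(s_{\mathbf{k}})_{\mathbf{k}\in\mathcal{K}}$ be given for the truncated moment problem $$\int \mathbf{t}^{\mathbf{k}}\,d\mu(\mathbf{t})=s_{\mathbf{k}},\qquad \mathbf{k}\in\mathcal{K},$$ and suppose that (with some indexation $K=\{\mathbf{k}_j\}_{j=0}^{\rho}$) the conditions $\Gamma\ge 0$ and $\operatorname{Ker}\Gamma_l\subseteq\operatorname{Ker}\widehat\Gamma_l$, $l=1,\dots,n$, are satisfied. If the set of moments $\mathcal{S}$ is dimensionally stable, then $\mathcal{S}$ is completely self-adjoint. In the case of triangular truncations, i.e. $K=K_r=\{\mathbf{k}\in\mathbb{Z}^n_+:|\mathbf{k}|\le r\}$ for some $r\in\mathbb{Z}_+$, the converse implication is also true: if $\mathcal{S}$ is completely self-adjoint, then $\mathcal{S}$ is dimensionally stable.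
   Context: Notation: $\mathbb{Z}_+$ is the set of non-negative integers; for $\mathbf{k}=(k_1,\dots,k_n)\in\mathbb{Z}^n_+$ and $\mathbf{t}=(t_1,\dots,t_n)\in\mathbb{R}^n$, $\mathbf{t}^{\mathbf{k}}=t_1^{k_1}\cdots t_n^{k_n}$ and $|\mathbf{k}|=k_1+\dots+k_n$; $\vec e_l\in\mathbb{Z}^n_+$ is the $l$-th standard unit vector. The unknown $\mu$ of the moment problem is a non-negative measure on the Borel sets of $\mathbb{R}^n$. Admissible set: a finite set $K\subset\mathbb{Z}^n_+$ is admissible if $\mathbf{0}\in K$ and every $\mathbf{k}\in K\setminus\{\mathbf{0}\}$ can be written as $\mathbf{k}=\vec e_{a_1}+\dots+\vec e_{a_{|\mathbf{k}|}}$ with some $a_j\in\{1,\dots,n\}$ such that all partial sums $\vec e_{a_1}+\dots+\vec e_{a_q}$, $q=1,\dots,|\mathbf{k}|$, belong to $K$. Indexation and matrices: write $K=\{\mathbf{k}_j: j=0,1,\dots,\rho\}$ (distinct elements). For $l=1,\dots,n$ put $\Omega_l=\{j\in\{0,\dots,\rho\}:\mathbf{k}_j+\vec e_l\in K\}$, and put $\Omega_0=\{j\in\{0,\dots,\rho\}:\mathbf{k}_j+\vec e_1,\dots,\mathbf{k}_j+\vec e_n\in K\}$. Define $$\Gamma=(s_{\mathbf{k}_j+\mathbf{k}_m})_{m,j=0}^{\rho},\quad \Gamma_l=(s_{\mathbf{k}_j+\mathbf{k}_m})_{m,j\in\Omega_l},\quad \widehat\Gamma_l=(s_{\mathbf{k}_j+\vec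 e_l+\mathbf{k}_m+\vec e_l})_{m,j\in\Omega_l},\quad l=1,\dots,n,$$ with indices from $\Omega_l$ taken in increasing order. $\Gamma\ge0$ means positive semidefinite. Associated Hilbert space: let $\mathfrak{L}$ be the complex vector space of polynomials $p(\mathbf{t})=\sum_{j=0}^{\rho}\alpha_j\mathbf{t}^{\mathbf{k}_j}$, $\alpha_j\in\mathbb{C}$, with the sesquilinear form $\langle p,q\rangle=\sum_{j,m=0}^{\rho}\alpha_j\overline{\beta_m}s_{\mathbf{k}_j+\mathbf{k}_m}$ for $q=\sum_{j=0}^\rho\beta_j\mathbf{t}^{\mathbf{k}_j}$. Since $\Gamma\ge0$, this form is positive semidefinite; $H$ is the finite-dimensional Hilbert space obtained as the quotient of $\mathfrak{L}$ by the null space of the form, and $[p]$ denotes the class of $p$. Operators: for $l=1,\dots,n$, $M_l$ is the linear operator in $H$ with domain $D(M_l)=\operatorname{Lin}\{[\mathbf{t}^{\mathbf{k}_j}]\}_{j\in\Omega_l}$ given by $$M_l\sum_{j\in\Omega_l}\alpha_j[\mathbf{t}^{\mathbf{k}_j}]=\sum_{j\in\Omega_l}\alpha_j[\mathbf{t}^{\mathbf{k}_j+\vec e_l}],\qquad \alpha_j\in\mathbb{C};$$ it is well defined because of the kernel conditions, it is symmetric, and it may be defined only on a proper subspace of $H$. Let $H_0=\operatorname{Lin}\{[\mathbf{t}^{\mathbf{k}_j}]\}_{j\in\Omega_0}$. $\mathcal{S}$ is called dimensionally stable if $\dim H=\dim H_0$. $\mathcal{S}$ is called completely self-adjoint if the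 operators $M_1,\dots,M_n$ are self-adjoint operators in $H$ (in particular, $D(M_l)=H$ for every $l$) and pairwise commute. *)

theory Defs
  imports
    "HOL-Library.Poly_Mapping"
    "Jordan_Normal_Form.VS_Connect"
    "Jordan_Normal_Form.Matrix_Kernel"
    "Jordan_Normal_Form.DL_Submatrix"
begin

text \<open>Multi-indices in \<open>n\<close> variables are functions \<open>'n \<Rightarrow>\<^sub>0 nat\<close> with \<open>'n\<close> a finite type,
  \<open>n = CARD('n)\<close>; complex polynomials are finitely supported coefficient functions on
  multi-indices. Only the values of \<open>s\<close> on \<open>K + K\<close> matter below.\<close>

type_synonym 'n mindex = "'n \<Rightarrow>\<^sub>0 nat"
type_synonym 'n cpoly = "'n mindex \<Rightarrow>\<^sub>0 complex"

definition unit_mi :: "'n \<Rightarrow> 'n mindex" where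
  "unit_mi l = Poly_Mapping.single l 1"

definition abs_mi :: "'n::finite mindex \<Rightarrow> nat" where
  "abs_mi k = (\<Sum>i\<in>UNIV. Poly_Mapping.lookup k i)"

definition admissible :: "'n::finite mindex set \<Rightarrow> bool" where
  "admissible K \<longleftrightarrow> finite K \<and> 0 \<in> K \<and>
     (\<forall>k \<in> K - {0}. \<exists>as. length as = abs_mi k \<and> k = sum_list (map unit_mi as) \<and>
        (\<forall>q \<in> {1..abs_mi k}. sum_list (map unit_mi (take q as)) \<in> K))"

definition triangular :: "nat \<Rightarrow> 'n::finite mindex set" where
  "triangular r = {k. abs_mi k \<le> r}"

text \<open>Moment matrices for an indexation \<open>k 0, \<dots>, k \<rho>\<close> of \<open>K\<close>. The function \<open>submatrix\<close> takes the
  indices from \<open>Omega \<rho> k l\<close> in increasing order.\<close>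

definition Omega :: "nat \<Rightarrow> (nat \<Rightarrow> 'n mindex) \<Rightarrow> 'n \<Rightarrow> nat set" where
  "Omega \<rho> k l = {j \<in> {0..\<rho>}. k j + unit_mi l \<in> k ` {0..\<rho>}}"

definition Gamma :: "nat \<Rightarrow> (nat \<Rightarrow> 'n mindex) \<Rightarrow> ('n mindex \<Rightarrow> real) \<Rightarrow> complex mat" where
  "Gamma \<rho> k s = mat (Suc \<rho>) (Suc \<rho>) (\<lambda>(m, j). complex_of_real (s (k j + k m)))"

definition Gamma_sub :: "nat \<Rightarrow> (nat \<Rightarrow> 'n mindex) \<Rightarrow> ('n mindex \<Rightarrow> real) \<Rightarrow> 'n \<Rightarrow> complex mat" where
  "Gamma_sub \<rho> k s l = submatrix (Gamma \<rho> k s) (Omega \<rho> k l) (Omega \<rho> k l)"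

definition Gamma_hat :: "nat \<Rightarrow> (nat \<Rightarrow> 'n mindex) \<Rightarrow> ('n mindex \<Rightarrow> real) \<Rightarrow> 'n \<Rightarrow> complex mat" where
  "Gamma_hat \<rho> k s l = submatrix (Gamma \<rho> (\<lambda>j. k j + unit_mi l) s) (Omega \<rho> k l) (Omega \<rho> k l)"

text \<open>In the order on \<^typ>\<open>complex\<close>, \<open>0 \<le> z\<close> says that \<open>z\<close> is real and non-negative; hence a
  matrix satisfying \<open>pos_semidef\<close> is automatically Hermitian.\<close>

definition pos_semidef :: "complex mat \<Rightarrow> bool" where
  "pos_semidef A \<longleftrightarrow> square_mat A \<and> (\<forall>v \<in> carrier_vec (dim_row A). 0 \<le> (A *\<^sub>v v) \<bullet>c v)"

text \<open>The space \<open>H\<close>: the quotient of the polynomials supported on \<open>K\<close> by the null space of the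
  form. Operations on classes are computed on arbitrary representatives; they do not depend on the
  choice as soon as the form is positive semidefinite. The ring multiplication of the module record
  is irrelevant.\<close>

definition polys :: "'n mindex set \<Rightarrow> 'n cpoly set" where
  "polys K = {p. Poly_Mapping.keys p \<subseteq> K}"

definition form :: "'n mindex set \<Rightarrow> ('n mindex \<Rightarrow> real) \<Rightarrow> 'n cpoly \<Rightarrow> 'n cpoly \<Rightarrow> complex" where
  "form K s p q =
     (\<Sum>a\<in>K. \<Sum>b\<in>K. Poly_Mapping.lookup p a * cnj (Poly_Mapping.lookup q b) *
       complex_of_real (s (a + b)))"

definition null_rel :: "'n mindex set \<Rightarrow> ('n mindex \<Rightarrow> real) \<Rightarrow> 'n cpoly rel" where
  "null_rel K s = {(p, q). p \<in> polys K \<and> q \<in> polys K \<and> form K s (p - q) (p - q) = 0}"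

definition cls :: "'n mindex set \<Rightarrow> ('n mindex \<Rightarrow> real) \<Rightarrow> 'n cpoly \<Rightarrow> 'n cpoly set" where
  "cls K s p = null_rel K s `` {p}"

definition rep :: "'n cpoly set \<Rightarrow> 'n cpoly" where
  "rep X = (SOME p. p \<in> X)"

definition hilb :: "'n mindex set \<Rightarrow> ('n mindex \<Rightarrow> real) \<Rightarrow> (complex, 'n cpoly set) module" where
  "hilb K s = \<lparr>carrier = polys K // null_rel K s, monoid.mult = undefined, one = undefined,
     zero = cls K s 0,
     add = (\<lambda>X Y. cls K s (rep X + rep Y)),
     smult = (\<lambda>c X. cls K s (Poly_Mapping.map ((*) c) (rep X)))\<rparr>"

definition hip :: "'n mindex set \<Rightarrow> ('n mindex \<Rightarrow> real) \<Rightarrow> 'n cpoly set \<Rightarrow> 'n cpoly set \<Rightarrow> complex" where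
  "hip K s X Y = form K s (rep X) (rep Y)"

definition mono_cls :: "'n mindex set \<Rightarrow> ('n mindex \<Rightarrow> real) \<Rightarrow> 'n mindex \<Rightarrow> 'n cpoly set" where
  "mono_cls K s k = cls K s (Poly_Mapping.single k 1)"

text \<open>Operators, possibly not everywhere defined, are given by their graphs. The graph \<open>mult_op\<close> is
  single-valued under the kernel conditions. The sets \<open>shiftable K l\<close> and \<open>shiftable_all K\<close> collect
  the multi-indices with index in \<open>\<Omega>\<^sub>l\<close> and \<open>\<Omega>\<^sub>0\<close>, so they do not depend on the indexation.\<close>

definition shiftable :: "'n mindex set \<Rightarrow> 'n \<Rightarrow> 'n mindex set" where
  "shiftable K l = {k \<in> K. k + unit_mi l \<in> K}"

definition shiftable_all :: "'n mindex set \<Rightarrow> 'n mindex set" where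
  "shiftable_all K = {k \<in> K. \<forall>l. k + unit_mi l \<in> K}"

definition mult_op ::
    "'n mindex set \<Rightarrow> ('n mindex \<Rightarrow> real) \<Rightarrow> 'n \<Rightarrow> ('n cpoly set \<times> 'n cpoly set) set" where
  "mult_op K s l =
     {(\<Oplus>\<^bsub>hilb K s\<^esub>k\<in>shiftable K l. \<alpha> k \<odot>\<^bsub>hilb K s\<^esub> mono_cls K s k,
       \<Oplus>\<^bsub>hilb K s\<^esub>k\<in>shiftable K l. \<alpha> k \<odot>\<^bsub>hilb K s\<^esub> mono_cls K s (k + unit_mi l)) | \<alpha>. True}"

definition H0 :: "'n mindex set \<Rightarrow> ('n mindex \<Rightarrow> real) \<Rightarrow> 'n cpoly set set" where
  "H0 K s = LinearCombinations.module.span class_ring (hilb K s) (mono_cls K s ` shiftable_all K)"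

definition densely_defined ::
    "(complex, 'h) module \<Rightarrow> ('h \<Rightarrow> 'h \<Rightarrow> complex) \<Rightarrow> ('h \<times> 'h) set \<Rightarrow> bool" where
  "densely_defined V ip A \<longleftrightarrow>
     (\<forall>x \<in> carrier V. \<forall>\<epsilon>>0. \<exists>y \<in> Domain A. sqrt (Re (ip (x \<ominus>\<^bsub>V\<^esub> y) (x \<ominus>\<^bsub>V\<^esub> y))) < \<epsilon>)"

definition adjoint_op ::
    "(complex, 'h) module \<Rightarrow> ('h \<Rightarrow> 'h \<Rightarrow> complex) \<Rightarrow> ('h \<times> 'h) set \<Rightarrow> ('h \<times> 'h) set" where
  "adjoint_op V ip A =
     {(y, z). y \<in> carrier V \<and> z \<in> carrier V \<and> (\<forall>(x, w) \<in> A. ip w y = ip x z)}"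

definition self_adjoint_op ::
    "(complex, 'h) module \<Rightarrow> ('h \<Rightarrow> 'h \<Rightarrow> complex) \<Rightarrow> ('h \<times> 'h) set \<Rightarrow> bool" where
  "self_adjoint_op V ip A \<longleftrightarrow>
     A \<subseteq> carrier V \<times> carrier V \<and> single_valued A \<and> densely_defined V ip A \<and> adjoint_op V ip A = A"

definition dimensionally_stable :: "'n mindex set \<Rightarrow> ('n mindex \<Rightarrow> real) \<Rightarrow> bool" where
  "dimensionally_stable K s \<longleftrightarrow>
     vectorspace.dim class_ring (hilb K s) = vectorspace.dim class_ring (hilb K s\<lparr>carrier := H0 K s\<rparr>)"

definition completely_self_adjoint :: "'n mindex set \<Rightarrow> ('n mindex \<Rightarrow> real) \<Rightarrow> bool" where
  "completely_self_adjoint K s \<longleftrightarrow>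
     (\<forall>l. self_adjoint_op (hilb K s) (hip K s) (mult_op K s l)) \<and>
     (\<forall>l m. mult_op K s l O mult_op K s m = mult_op K s m O mult_op K s l)"

end

theory Submission
  imports Defs
begin

text \<open>
  Write \<open>\<Omega>\<^sub>l\<close> for the multi-indices of \<open>K\<close> that stay in \<open>K\<close> when shifted by the unit multi-index
  \<open>e\<^sub>l\<close>, and \<open>\<Omega>\<^sub>0\<close> for those that do so for all \<open>l\<close> at once. The Hankel structure of the moment
  matrix, \<open>\<langle>t\<^sup>a, t\<^sup>b\<rangle> = s\<^bsub>a + b\<^esub>\<close>, makes a shift by \<open>e\<^sub>l\<close> movable from one argument of the form to the
  other, so each \<open>M\<^sub>l\<close> is symmetric (\<open>mult_op_symmetric\<close>).

  Suppose \<open>dim H = dim H\<^sub>0\<close>. Then \<open>H\<^sub>0 = H\<close>, and as \<open>\<Omega>\<^sub>0 \<subseteq> \<Omega>\<^sub>l\<close> each \<open>M\<^sub>l\<close> is a symmetric operator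
  on all of \<open>H\<close>, that is, a self-adjoint one (\<open>mult_op_self_adjoint\<close>). To see that \<open>M\<^sub>l\<close> and \<open>M\<^sub>m\<close>
  commute one must avoid computing \<open>M\<^sub>m M\<^sub>l t\<^sup>a\<close>, because \<open>a + e\<^sub>l + e\<^sub>m\<close> may lie outside \<open>K\<close>. But for
  \<open>a, b \<in> \<Omega>\<^sub>0\<close> symmetry gives \<open>\<langle>M\<^sub>m M\<^sub>l t\<^sup>a, t\<^sup>b\<rangle> = \<langle>M\<^sub>l t\<^sup>a, M\<^sub>m t\<^sup>b\<rangle> = s\<close> at
  \<open>a + b + e\<^sub>l + e\<^sub>m\<close>, which is symmetric in \<open>l\<close> and \<open>m\<close>; since \<open>H\<^sub>0 = H\<close>, these inner products
  determine the operator (\<open>mult_op_comp_form\<close>, \<open>mult_op_commute\<close>).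

  Conversely, a self-adjoint \<open>M\<^sub>l\<close> is everywhere defined: if \<open>u\<close> is orthogonal to its domain, then
  \<open>(0, u)\<close> belongs to the graph of the adjoint, which is the graph of \<open>M\<^sub>l\<close>, so \<open>u = 0\<close>
  (\<open>self_adjoint_imp_total\<close>). For a triangular \<open>K\<close> all the sets \<open>\<Omega>\<^sub>l\<close> coincide with \<open>\<Omega>\<^sub>0\<close>, because
  membership only depends on the degree; hence \<open>H\<^sub>0\<close> is the domain of \<open>M\<^sub>l\<close>, which is \<open>H\<close>.

  The classes in \<open>H\<close> are handled through the form alone: two polynomials have the same class iff they
  have the same form against every polynomial (\<open>cls_eq_iff\<close>). The kernel condition on the moment
  matrices enters only to make \<open>M\<^sub>l\<close> single-valued (\<open>single_valued_mult_op\<close>).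
\<close>

section \<open>Subspaces of full dimension\<close>

text \<open>A basis of the span is linearly independent in the whole space too, and by the hypothesis on the
  dimensions it has enough elements to be a basis there.\<close>

lemma (in vectorspace) span_eq_carrier_if_dim_eq:
  assumes fin_dim: "fin_dim" and S: "finite S" "S \<subseteq> carrier V"
    and dim: "dim = vectorspace.dim K (vs (span S))"
  shows "span S = carrier V"
proof -
  have sub: "submodule K (span S) V" using S(2) by (rule span_is_submodule)
  interpret W: vectorspace K "vs (span S)"
    using span_is_subspace[OF S(2)] by (rule subspace_is_vs)
  have SW: "S \<subseteq> span S" using in_own_span[OF S(2)] .
  have "W.fin_dim"
    unfolding W.fin_dim_def using S(1) SW span_li_not_depend(1)[OF SW sub] by auto
  then obtain B where B: "finite B" "W.basis B"
    using W.finite_basis_exists by blast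
  have BW: "B \<subseteq> span S" using B(2) by (simp add: W.basis_def)
  have BV: "B \<subseteq> carrier V" using BW span_is_subset2[OF S(2)] by blast
  have "lin_indpt B" "span B = span S"
    using B(2) span_li_not_depend[OF BW sub] by (simp_all add: W.basis_def)
  moreover have "dim \<le> card B" using W.dim_basis[OF B] dim by simp
  ultimately show ?thesis
    using dim_li_is_basis[OF fin_dim B(1) BV] by (simp add: basis_def)
qed

section \<open>The moment form\<close>

lemma lookup_map_mult [simp]:
  "Poly_Mapping.lookup (Poly_Mapping.map ((*) c) p) a = c * Poly_Mapping.lookup p a"
  for c :: "'b::mult_zero"
  by (simp add: Poly_Mapping.map.rep_eq when_def)

text \<open>The two components of an element of a multiplication operator are the sums of this kind with
  the same coefficients over the same indices, once with exponents \<open>a\<close> and once with exponents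
  \<open>a + e\<^sub>l\<close>.\<close>

definition mono_sum ::
    "'a set \<Rightarrow> ('a \<Rightarrow> 'n mindex) \<Rightarrow> ('a \<Rightarrow> complex) \<Rightarrow> 'n cpoly" where
  "mono_sum S g \<alpha> = (\<Sum>a\<in>S. Poly_Mapping.single (g a) (\<alpha> a))"

lemma polys_zero: "0 \<in> polys K"
  by (simp add: polys_def)

lemma polys_add: "p \<in> polys K \<Longrightarrow> q \<in> polys K \<Longrightarrow> p + q \<in> polys K"
  using Poly_Mapping.keys_add[of p q] by (auto simp: polys_def)

lemma polys_diff: "p \<in> polys K \<Longrightarrow> q \<in> polys K \<Longrightarrow> p - q \<in> polys K"
  using Poly_Mapping.keys_diff[of p q] by (auto simp: polys_def)

lemma polys_smult: "p \<in> polys K \<Longrightarrow> Poly_Mapping.map ((*) c) p \<in> polys K"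
  by (auto simp: polys_def in_keys_iff)

lemma polys_single: "a \<in> K \<Longrightarrow> Poly_Mapping.single a c \<in> polys K"
  by (auto simp: polys_def split: if_splits)

lemma polys_sum: "(\<And>i. i \<in> I \<Longrightarrow> f i \<in> polys K) \<Longrightarrow> (\<Sum>i\<in>I. f i) \<in> polys K"
  by (induction I rule: infinite_finite_induct) (auto simp: polys_zero polys_add)

lemma polys_mono: "S \<subseteq> K \<Longrightarrow> p \<in> polys S \<Longrightarrow> p \<in> polys K"
  by (auto simp: polys_def)

lemma mono_sum_in_polys: "g ` S \<subseteq> K \<Longrightarrow> mono_sum S g \<alpha> \<in> polys K"
  by (auto simp: mono_sum_def intro!: polys_sum polys_single)

lemma polysE:
  assumes "finite S" "p \<in> polys S"
  obtains \<alpha> where "p = mono_sum S (\<lambda>a. a) \<alpha>"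
proof
  show "p = mono_sum S (\<lambda>a. a) (Poly_Mapping.lookup p)"
    using assms
    by (intro poly_mapping_eqI)
      (auto simp: mono_sum_def lookup_sum lookup_single when_def polys_def in_keys_iff)
qed

lemma form_add_left: "form K s (p + p') q = form K s p q + form K s p' q"
  by (simp add: form_def lookup_add algebra_simps sum.distrib)

lemma form_smult_left: "form K s (Poly_Mapping.map ((*) c) p) q = c * form K s p q"
  by (simp add: form_def sum_distrib_left mult.assoc)

lemma form_hermitian: "form K s q p = cnj (form K s p q)"
proof -
  have "cnj (form K s p q) = (\<Sum>a\<in>K. \<Sum>b\<in>K. Poly_Mapping.lookup q b *
      cnj (Poly_Mapping.lookup p a) * complex_of_real (s (b + a)))"
    by (simp add: form_def mult_ac add.commute)
  also have "\<dots> = form K s q p"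
    unfolding form_def by (rule sum.swap)
  finally show ?thesis by simp
qed

lemma form_add_right: "form K s p (q + q') = form K s p q + form K s p q'"
  by (metis form_hermitian form_add_left complex_cnj_add)

lemma form_smult_right: "form K s p (Poly_Mapping.map ((*) c) q) = cnj c * form K s p q"
  by (metis form_hermitian form_smult_left complex_cnj_mult)

lemma form_zero_left [simp]: "form K s 0 q = 0"
  by (simp add: form_def)

lemma form_zero_right [simp]: "form K s p 0 = 0"
  by (simp add: form_def)

lemma form_diff_left: "form K s (p - p') q = form K s p q - form K s p' q"
  by (metis form_add_left diff_add_cancel add_diff_cancel_right')

lemma form_sum_left: "form K s (\<Sum>i\<in>I. f i) q = (\<Sum>i\<in>I. form K s (f i) q)"
  by (induction I rule: infinite_finite_induct) (auto simp: form_add_left)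

lemma form_sum_right: "form K s p (\<Sum>i\<in>I. f i) = (\<Sum>i\<in>I. form K s p (f i))"
  by (induction I rule: infinite_finite_induct) (auto simp: form_add_right)

lemma form_single:
  assumes "finite K" "a \<in> K" "b \<in> K"
  shows "form K s (Poly_Mapping.single a c) (Poly_Mapping.single b d)
    = c * cnj d * complex_of_real (s (a + b))"
proof -
  have "form K s (Poly_Mapping.single a c) (Poly_Mapping.single b d)
      = (\<Sum>a'\<in>K. if a = a' then \<Sum>b'\<in>K. if b = b' then
          c * cnj d * complex_of_real (s (a' + b')) else 0 else 0)"
    unfolding form_def by (auto intro!: sum.cong simp: lookup_single when_def)
  then show ?thesis
    using assms by simp
qed

lemma form_mono_sum:
  assumes "finite K" "g ` S \<subseteq> K" "h ` T \<subseteq> K"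
  shows "form K s (mono_sum S g \<alpha>) (mono_sum T h \<beta>)
    = (\<Sum>a\<in>S. \<Sum>b\<in>T. \<alpha> a * cnj (\<beta> b) * complex_of_real (s (g a + h b)))"
  using assms unfolding mono_sum_def form_sum_left unfolding form_sum_right
  by (auto intro!: sum.cong form_single)

locale moment_form =
  fixes K :: "'n::finite mindex set" and s :: "'n mindex \<Rightarrow> real"
  assumes finite_K: "finite K"
    and psd: "0 \<le> Re (form K s p p)"
begin

text \<open>This case of the Cauchy-Schwarz inequality is what makes the form well defined on the quotient:
  moving \<open>q\<close> along a multiple of the null vector \<open>p\<close> changes \<open>\<langle>q, q\<rangle>\<close> by a term linear in that
  multiple, which would become negative if \<open>\<langle>p, q\<rangle>\<close> were not zero.\<close>

lemma null_vector_orthogonal: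
  assumes "form K s p p = 0"
  shows "form K s p q = 0"
proof (rule ccontr)
  define f where "f = form K s p q"
  define Q where "Q = Re (form K s q q)"
  assume "form K s p q \<noteq> 0"
  then have f: "(cmod f)\<^sup>2 > 0" by (simp add: f_def)
  have ineq: "2 * t * (cmod f)\<^sup>2 \<le> Q" for t :: real
  proof -
    \<comment> \<open>The phase of the multiple makes the cross term \<open>- t \<bar>f\<bar>\<^sup>2\<close> real.\<close>
    define c where "c = - (complex_of_real t * cnj f)"
    have "form K s (q + Poly_Mapping.map ((*) c) p) (q + Poly_Mapping.map ((*) c) p)
        = form K s q q + c * f + cnj (c * f)"
      using assms form_hermitian[of K s p q]
      by (simp add: form_add_left form_add_right form_smult_left form_smult_right f_def
          form_hermitian[of K s q p])
    moreover have "c * f = - complex_of_real (t * (cmod f)\<^sup>2)"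
      by (simp only: c_def of_real_mult complex_norm_square) (simp add: mult_ac)
    ultimately have "Re (form K s (q + Poly_Mapping.map ((*) c) p)
        (q + Poly_Mapping.map ((*) c) p)) = Q - 2 * t * (cmod f)\<^sup>2"
      by (simp add: Q_def)
    then show ?thesis
      using psd[of "q + Poly_Mapping.map ((*) c) p"] by simp
  qed
  show False
    using ineq[of "(Q + 1) / (cmod f)\<^sup>2"] f ineq[of 0] by simp
qed

lemma null_rel_iff:
  "(p, q) \<in> null_rel K s \<longleftrightarrow>
     p \<in> polys K \<and> q \<in> polys K \<and> (\<forall>r. form K s p r = form K s q r)"
proof -
  have "form K s (p - q) (p - q) = 0 \<longleftrightarrow> (\<forall>r. form K s (p - q) r = 0)"
    using null_vector_orthogonal by blast
  then show ?thesis
    by (auto simp: null_rel_def form_diff_left)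
qed

text \<open>The right-hand side is additive and homogeneous in \<open>p\<close> and \<open>q\<close>, so every identity between classes
  below reduces to the sesquilinearity of the form.\<close>

lemma cls_eq_iff:
  assumes "p \<in> polys K" "q \<in> polys K"
  shows "cls K s p = cls K s q \<longleftrightarrow> (\<forall>r. form K s p r = form K s q r)"
  using assms by (auto simp: cls_def set_eq_iff null_rel_iff)

lemma rep_cls:
  assumes "p \<in> polys K"
  shows "rep (cls K s p) \<in> polys K" "form K s (rep (cls K s p)) r = form K s p r"
proof -
  have "p \<in> cls K s p"
    using assms by (simp add: cls_def null_rel_iff)
  then have "rep (cls K s p) \<in> cls K s p"
    unfolding rep_def by (rule someI)
  then show "rep (cls K s p) \<in> polys K" "form K s (rep (cls K s p)) r = form K s p r"
    by (auto simp: cls_def null_rel_iff)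
qed

lemma hip_cls:
  assumes "p \<in> polys K" "q \<in> polys K"
  shows "hip K s (cls K s p) (cls K s q) = form K s p q"
  unfolding hip_def using rep_cls[OF assms(1)] rep_cls[OF assms(2)] by (metis form_hermitian)

lemma hip_hermitian: "hip K s y x = cnj (hip K s x y)"
  unfolding hip_def by (rule form_hermitian)

section \<open>The quotient as a vector space\<close>

lemma carrier_hilb: "carrier (hilb K s) = cls K s ` polys K"
  by (auto simp: hilb_def quotient_def cls_def)

lemma zero_hilb: "\<zero>\<^bsub>hilb K s\<^esub> = cls K s 0"
  by (simp add: hilb_def)

lemma add_hilb:
  assumes "p \<in> polys K" "q \<in> polys K"
  shows "cls K s p \<oplus>\<^bsub>hilb K s\<^esub> cls K s q = cls K s (p + q)"
  using assms by (simp add: hilb_def cls_eq_iff polys_add rep_cls form_add_left)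

lemma smult_hilb:
  assumes "p \<in> polys K"
  shows "c \<odot>\<^bsub>hilb K s\<^esub> cls K s p = cls K s (Poly_Mapping.map ((*) c) p)"
  using assms by (simp add: hilb_def cls_eq_iff polys_smult rep_cls form_smult_left)

lemma vectorspace_hilb: "vectorspace class_ring (hilb K s)"
proof (rule vs_criteria, goal_cases)
  case 1
  show ?case by (rule class_field)
next
  case 4
  have "cls K s p \<oplus>\<^bsub>hilb K s\<^esub> cls K s (Poly_Mapping.map ((*) (- 1)) p) = cls K s 0"
    if "p \<in> polys K" for p
    using that by (simp add: add_hilb polys_smult polys_add polys_zero cls_eq_iff form_add_left
        form_smult_left)
  then show ?case
    by (metis (no_types, lifting) carrier_hilb zero_hilb polys_smult image_iff)
qed (auto simp: carrier_hilb zero_hilb add_hilb smult_hilb cls_eq_iff polys_zero polys_add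
    polys_smult form_add_left form_smult_left algebra_simps del: subset_antisym)

sublocale hilb: vectorspace class_ring "hilb K s"
  by (rule vectorspace_hilb)

lemma finsum_hilb:
  assumes "finite I" "\<And>i. i \<in> I \<Longrightarrow> f i \<in> polys K"
  shows "(\<Oplus>\<^bsub>hilb K s\<^esub>i\<in>I. cls K s (f i)) = cls K s (\<Sum>i\<in>I. f i)"
  using assms
proof (induction I rule: finite_induct)
  case empty
  then show ?case by (simp add: zero_hilb)
next
  case (insert i I)
  then have "(\<lambda>i. cls K s (f i)) \<in> I \<rightarrow> carrier (hilb K s)"
    by (auto simp: carrier_hilb)
  with insert show ?case
    by (simp add: carrier_hilb polys_sum add_hilb)
qed

lemma smult_mono_cls:
  assumes "a \<in> K"
  shows "c \<odot>\<^bsub>hilb K s\<^esub> mono_cls K s a = cls K s (Poly_Mapping.single a c)"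
proof -
  have "Poly_Mapping.map ((*) c) (Poly_Mapping.single a 1) = Poly_Mapping.single a c"
    by (rule poly_mapping_eqI) (simp add: lookup_single when_def)
  then show ?thesis
    using assms by (simp add: mono_cls_def smult_hilb polys_single)
qed

lemma finsum_mono_cls:
  assumes "finite S" "g ` S \<subseteq> K"
  shows "(\<Oplus>\<^bsub>hilb K s\<^esub>a\<in>S. \<alpha> a \<odot>\<^bsub>hilb K s\<^esub> mono_cls K s (g a)) = cls K s (mono_sum S g \<alpha>)"
proof -
  have "(\<Oplus>\<^bsub>hilb K s\<^esub>a\<in>S. \<alpha> a \<odot>\<^bsub>hilb K s\<^esub> mono_cls K s (g a))
      = (\<Oplus>\<^bsub>hilb K s\<^esub>a\<in>S. cls K s (Poly_Mapping.single (g a) (\<alpha> a)))"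
    using assms by (intro hilb.finsum_cong') (auto simp: smult_mono_cls carrier_hilb polys_single)
  then show ?thesis
    using assms by (subst (asm) finsum_hilb) (auto simp: mono_sum_def polys_single)
qed

text \<open>The spans of the monomial classes are thus images of polynomial spaces; this is how
  \<open>H\<^sub>0\<close> and the domains of the operators become comparable.\<close>

lemma span_mono_cls:
  assumes "S \<subseteq> K"
  shows "LinearCombinations.module.span class_ring (hilb K s) (mono_cls K s ` S)
    = cls K s ` polys S"
proof
  have fin: "finite S" using assms finite_K finite_subset by blast
  have sub: "polys S \<subseteq> polys K" using assms polys_mono by blast
  have gen: "mono_cls K s ` S \<subseteq> cls K s ` polys S"
    by (auto simp: mono_cls_def polys_single)
  have "submodule class_ring (cls K s ` polys S) (hilb K s)"
    using sub hilb.module_axioms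
    by (unfold_locales)
      (auto simp: submodule_def carrier_hilb zero_hilb polys_zero add_hilb smult_hilb subset_iff
        intro!: imageI polys_add polys_smult)
  with gen show "hilb.span (mono_cls K s ` S) \<subseteq> cls K s ` polys S"
    by (rule hilb.span_is_subset)
  have car: "mono_cls K s ` S \<subseteq> carrier (hilb K s)"
    using gen sub unfolding carrier_hilb by blast
  interpret sp: submodule class_ring "hilb.span (mono_cls K s ` S)" "hilb K s"
    using car by (rule hilb.span_is_submodule)
  have "cls K s (mono_sum T (\<lambda>a. a) \<alpha>) \<in> hilb.span (mono_cls K s ` S)" if "T \<subseteq> S" for T \<alpha>
    using finite_subset[OF that fin] that
  proof (induction T rule: finite_induct)
    case empty
    show ?case using sp.zero_closed by (simp add: mono_sum_def zero_hilb)
  next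
    case (insert a T)
    have "cls K s (mono_sum (insert a T) (\<lambda>a. a) \<alpha>)
        = \<alpha> a \<odot>\<^bsub>hilb K s\<^esub> mono_cls K s a \<oplus>\<^bsub>hilb K s\<^esub> cls K s (mono_sum T (\<lambda>a. a) \<alpha>)"
    proof -
      have "mono_sum (insert a T) (\<lambda>a. a) \<alpha>
          = Poly_Mapping.single a (\<alpha> a) + mono_sum T (\<lambda>a. a) \<alpha>"
        using insert.hyps by (simp add: mono_sum_def)
      moreover have "mono_sum T (\<lambda>a. a) \<alpha> \<in> polys K" "a \<in> K"
        using insert.prems assms by (auto intro!: mono_sum_in_polys)
      ultimately show ?thesis
        by (simp add: smult_mono_cls add_hilb polys_single)
    qed
    moreover have "mono_cls K s a \<in> hilb.span (mono_cls K s ` S)"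
      using insert hilb.in_own_span[OF car] by auto
    ultimately show ?case
      using insert sp.smult_closed sp.m_closed by auto
  qed
  then show "cls K s ` polys S \<subseteq> hilb.span (mono_cls K s ` S)"
    by (auto elim: polysE[OF fin])
qed

lemma H0_eq: "H0 K s = cls K s ` polys (shiftable_all K)"
  unfolding H0_def by (rule span_mono_cls) (auto simp: shiftable_all_def)

lemma fin_dim_hilb: "hilb.fin_dim"
  unfolding hilb.fin_dim_def
  using span_mono_cls[OF order_refl] finite_K
  by (intro exI[of _ "mono_cls K s ` K"])
    (auto simp: carrier_hilb mono_cls_def polys_single)


lemma dimensionally_stable_imp_H0_full:
  assumes "dimensionally_stable K s"
  shows "H0 K s = carrier (hilb K s)"
proof -
  have "shiftable_all K \<subseteq> K" by (auto simp: shiftable_all_def)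
  then have "finite (mono_cls K s ` shiftable_all K)"
    "mono_cls K s ` shiftable_all K \<subseteq> carrier (hilb K s)"
    using finite_K finite_subset by (auto simp: carrier_hilb mono_cls_def polys_single)
  then show ?thesis
    using assms fin_dim_hilb hilb.span_eq_carrier_if_dim_eq
    unfolding H0_def dimensionally_stable_def by blast
qed

section \<open>The multiplication operators\<close>

lemma shiftable_subset: "shiftable K l \<subseteq> K" "(\<lambda>a. a + unit_mi l) ` shiftable K l \<subseteq> K"
  "shiftable_all K \<subseteq> shiftable K l"
  by (auto simp: shiftable_def shiftable_all_def)

lemma finite_shiftable: "finite (shiftable K l)"
  using finite_subset[OF shiftable_subset(1) finite_K] .

lemma mult_op_eq: "mult_op K s l =
    {(cls K s (mono_sum (shiftable K l) (\<lambda>a. a) \<alpha>),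
      cls K s (mono_sum (shiftable K l) (\<lambda>a. a + unit_mi l) \<alpha>)) | \<alpha>. True}"
  using shiftable_subset(1,2)[of l] finite_shiftable[of l]
  by (simp add: mult_op_def finsum_mono_cls[where g = "\<lambda>a. a"] finsum_mono_cls)

text \<open>The coefficients may be restricted to a part of the shiftable multi-indices, in particular to those
  that are shiftable in all directions.\<close>

lemma mult_op_memI:
  assumes "S \<subseteq> shiftable K l"
  shows "(cls K s (mono_sum S (\<lambda>a. a) \<alpha>), cls K s (mono_sum S (\<lambda>a. a + unit_mi l) \<alpha>))
    \<in> mult_op K s l"
proof -
  have "mono_sum (shiftable K l) g (\<lambda>a. if a \<in> S then \<alpha> a else 0) = mono_sum S g \<alpha>"
    for g :: "'n mindex \<Rightarrow> 'n mindex"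
    using assms finite_shiftable
    by (auto simp: mono_sum_def intro!: sum.mono_neutral_cong_right)
  then show ?thesis
    unfolding mult_op_eq
    by (intro CollectI exI[of _ "\<lambda>a. if a \<in> S then \<alpha> a else 0"]) simp
qed

lemma mult_op_subset: "mult_op K s l \<subseteq> carrier (hilb K s) \<times> carrier (hilb K s)"
  using shiftable_subset[of l] by (auto simp: mult_op_eq carrier_hilb mono_sum_in_polys)

lemma Domain_mult_op: "Domain (mult_op K s l) = cls K s ` polys (shiftable K l)"
proof
  show "Domain (mult_op K s l) \<subseteq> cls K s ` polys (shiftable K l)"
    by (auto simp: mult_op_eq mono_sum_in_polys)
  show "cls K s ` polys (shiftable K l) \<subseteq> Domain (mult_op K s l)"
    using mult_op_memI[OF order_refl] by (auto elim!: polysE[OF finite_shiftable])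
qed

text \<open>Both sides are sums of \<open>s (a + b + e\<^sub>l)\<close>: the form does not record which of its arguments was
  shifted.\<close>

lemma mult_op_symmetric:
  assumes "(x, w) \<in> mult_op K s l" "(y, z) \<in> mult_op K s l"
  shows "hip K s w y = hip K s x z"
proof -
  obtain \<alpha> \<beta> where
    x: "x = cls K s (mono_sum (shiftable K l) (\<lambda>a. a) \<alpha>)" and
    w: "w = cls K s (mono_sum (shiftable K l) (\<lambda>a. a + unit_mi l) \<alpha>)" and
    y: "y = cls K s (mono_sum (shiftable K l) (\<lambda>a. a) \<beta>)" and
    z: "z = cls K s (mono_sum (shiftable K l) (\<lambda>a. a + unit_mi l) \<beta>)"
    using assms unfolding mult_op_eq by blast
  show ?thesis
    unfolding x w y z using shiftable_subset(1,2)[of l] finite_K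
    by (simp add: hip_cls mono_sum_in_polys form_mono_sum add_ac)
qed

lemma hip_eqI:
  assumes "z \<in> carrier (hilb K s)" "z' \<in> carrier (hilb K s)"
    and "\<And>x. x \<in> carrier (hilb K s) \<Longrightarrow> hip K s z x = hip K s z' x"
  shows "z = z'"
proof -
  obtain p q where pq: "p \<in> polys K" "q \<in> polys K" "z = cls K s p" "z' = cls K s q"
    using assms(1,2) by (auto simp: carrier_hilb)
  have "form K s p r = form K s q r" if "r \<in> polys K" for r
    using assms(3)[of "cls K s r"] that pq by (simp add: hip_cls carrier_hilb)
  then have "form K s (p - q) (p - q) = 0"
    using pq by (simp add: form_diff_left polys_diff)
  then show ?thesis
    using pq null_vector_orthogonal[of "p - q"] by (simp add: cls_eq_iff form_diff_left)
qed

text \<open>For an everywhere defined symmetric operator, an element \<open>(y, z)\<close> of the adjoint can be compared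
  with the value \<open>z'\<close> of the operator at \<open>y\<close>: both have the same inner product with every vector.\<close>

lemma mult_op_self_adjoint:
  assumes single: "single_valued (mult_op K s l)"
    and total: "Domain (mult_op K s l) = carrier (hilb K s)"
  shows "self_adjoint_op (hilb K s) (hip K s) (mult_op K s l)"
  unfolding self_adjoint_op_def
proof (intro conjI)
  show "mult_op K s l \<subseteq> carrier (hilb K s) \<times> carrier (hilb K s)"
    by (rule mult_op_subset)
  show "single_valued (mult_op K s l)" by (rule single)
  have "x \<ominus>\<^bsub>hilb K s\<^esub> x = cls K s 0" if "x \<in> carrier (hilb K s)" for x
    using that by (simp add: zero_hilb[symmetric] hilb.minus_other_side)
  then show "densely_defined (hilb K s) (hip K s) (mult_op K s l)"
    unfolding densely_defined_def total
    by (metis hip_cls polys_zero form_zero_left zero_complex.sel(1) real_sqrt_zero)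
  have "(y, z) \<in> mult_op K s l" if adj: "(y, z) \<in> adjoint_op (hilb K s) (hip K s) (mult_op K s l)"
    for y z
  proof -
    have y: "y \<in> carrier (hilb K s)" and z: "z \<in> carrier (hilb K s)"
      and eq: "\<And>x w. (x, w) \<in> mult_op K s l \<Longrightarrow> hip K s w y = hip K s x z"
      using adj by (auto simp: adjoint_op_def)
    obtain z' where z': "(y, z') \<in> mult_op K s l"
      using y total by blast
    have "z = z'"
    proof (rule hip_eqI)
      show "z' \<in> carrier (hilb K s)" using z' mult_op_subset by blast
      fix x assume "x \<in> carrier (hilb K s)"
      then obtain w where w: "(x, w) \<in> mult_op K s l" using total by blast
      have "hip K s x z = hip K s x z'"
        using eq[OF w] mult_op_symmetric[OF w z'] by simp
      then show "hip K s z x = hip K s z' x"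
        by (simp add: hip_hermitian[of z] hip_hermitian[of z'])
    qed (rule z)
    with z' show ?thesis by simp
  qed
  moreover have "mult_op K s l \<subseteq> adjoint_op (hilb K s) (hip K s) (mult_op K s l)"
    using mult_op_subset mult_op_symmetric by (fastforce simp: adjoint_op_def)
  ultimately show "adjoint_op (hilb K s) (hip K s) (mult_op K s l) = mult_op K s l"
    by auto
qed

text \<open>The exponent \<open>a + e\<^sub>l + e\<^sub>m\<close> of \<open>M\<^sub>m M\<^sub>l t\<^sup>a\<close> may lie outside \<open>K\<close>, so the second operator is moved to
  the other argument, where it acts on \<open>t\<^sup>b\<close>.\<close>

lemma mult_op_comp_form:
  assumes single: "single_valued (mult_op K s l)"
    and xy: "(x, y) \<in> mult_op K s l" and yz: "(y, z) \<in> mult_op K s m"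
    and x: "x = cls K s (mono_sum (shiftable_all K) (\<lambda>a. a) \<alpha>)"
  shows "hip K s z (cls K s (mono_sum (shiftable_all K) (\<lambda>a. a) \<beta>))
    = (\<Sum>a\<in>shiftable_all K. \<Sum>b\<in>shiftable_all K.
        \<alpha> a * cnj (\<beta> b) * complex_of_real (s (a + unit_mi l + (b + unit_mi m))))"
proof -
  have y: "y = cls K s (mono_sum (shiftable_all K) (\<lambda>a. a + unit_mi l) \<alpha>)"
    using single xy mult_op_memI[OF shiftable_subset(3)] unfolding x
    by (rule single_valuedD)
  have "hip K s z (cls K s (mono_sum (shiftable_all K) (\<lambda>a. a) \<beta>))
      = hip K s y (cls K s (mono_sum (shiftable_all K) (\<lambda>a. a + unit_mi m) \<beta>))"
    using yz mult_op_memI[OF shiftable_subset(3)] by (rule mult_op_symmetric)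
  moreover have "(\<lambda>a. a + unit_mi l') ` shiftable_all K \<subseteq> K" for l'
    by (auto simp: shiftable_all_def)
  ultimately show ?thesis
    unfolding y using finite_K by (simp add: hip_cls mono_sum_in_polys form_mono_sum)
qed

text \<open>The sum obtained for \<open>M\<^sub>m M\<^sub>l\<close> does not change when \<open>l\<close> and \<open>m\<close> are exchanged, and its second argument
  runs through all of \<open>H\<close>. The inclusion in one direction suffices, as \<open>l\<close> and \<open>m\<close> are arbitrary.\<close>

lemma mult_op_commute:
  assumes full: "H0 K s = carrier (hilb K s)"
    and single: "\<And>l. single_valued (mult_op K s l)"
    and total: "\<And>l. Domain (mult_op K s l) = carrier (hilb K s)"
  shows "mult_op K s l O mult_op K s m \<subseteq> mult_op K s m O mult_op K s l"
proof (rule subrelI)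
  fix x z assume "(x, z) \<in> mult_op K s l O mult_op K s m"
  then obtain y where y: "(x, y) \<in> mult_op K s l" "(y, z) \<in> mult_op K s m"
    by (rule relcompEpair)
  have in_carrier: "u \<in> carrier (hilb K s) \<and> v \<in> carrier (hilb K s)"
    if "(u, v) \<in> mult_op K s l'" for u v l'
    using that mult_op_subset[of l'] by blast
  have defined: "\<exists>v. (u, v) \<in> mult_op K s l'" if "u \<in> carrier (hilb K s)" for u l'
    using that total[of l'] by blast
  have x: "x \<in> carrier (hilb K s)" using in_carrier[OF y(1)] by simp
  obtain y' where y': "(x, y') \<in> mult_op K s m" using defined[OF x] by blast
  obtain z' where z': "(y', z') \<in> mult_op K s l" using defined in_carrier[OF y'] by blast
  have fin: "finite (shiftable_all K)"
    using finite_subset[OF shiftable_subset(3) finite_shiftable] .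
  have repr: "\<exists>\<alpha>. v = cls K s (mono_sum (shiftable_all K) (\<lambda>a. a) \<alpha>)"
    if "v \<in> carrier (hilb K s)" for v
    using that unfolding full[symmetric] H0_eq by (auto elim: polysE[OF fin])
  obtain \<alpha> where \<alpha>: "x = cls K s (mono_sum (shiftable_all K) (\<lambda>a. a) \<alpha>)"
    using repr[OF x] by blast
  have "z = z'"
  proof (rule hip_eqI)
    show "z \<in> carrier (hilb K s)" "z' \<in> carrier (hilb K s)"
      using in_carrier[OF y(2)] in_carrier[OF z'] by simp_all
    fix v assume "v \<in> carrier (hilb K s)"
    then obtain \<beta> where \<beta>: "v = cls K s (mono_sum (shiftable_all K) (\<lambda>a. a) \<beta>)"
      using repr by blast
    show "hip K s z v = hip K s z' v"
      unfolding \<beta> mult_op_comp_form[OF single y \<alpha>] mult_op_comp_form[OF single y' z' \<alpha>]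
      by (simp add: add_ac)
  qed
  with y' z' show "(x, z) \<in> mult_op K s m O mult_op K s l" by blast
qed

lemma H0_full_imp_completely_self_adjoint:
  assumes full: "H0 K s = carrier (hilb K s)"
    and single: "\<And>l. single_valued (mult_op K s l)"
  shows "completely_self_adjoint K s"
proof -
  have total: "Domain (mult_op K s l) = carrier (hilb K s)" for l
  proof
    show "Domain (mult_op K s l) \<subseteq> carrier (hilb K s)"
      using mult_op_subset[of l] by blast
    show "carrier (hilb K s) \<subseteq> Domain (mult_op K s l)"
      unfolding full[symmetric] H0_eq Domain_mult_op
      using polys_mono[OF shiftable_subset(3)] by blast
  qed
  show ?thesis
    unfolding completely_self_adjoint_def
    using mult_op_self_adjoint[OF single total] mult_op_commute[OF full single total] by blast
qed

section \<open>Self-adjoint operators are everywhere defined\<close>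

text \<open>This is the Gram-Schmidt process for a form that may have null vectors. If the orthogonalised new
  monomial \<open>u\<close> is null, then it is orthogonal to everything; the coefficient \<open>t\<close> is \<open>0\<close> in that case,
  being a quotient by \<open>0\<close>.\<close>

lemma orthogonal_projection_polys:
  assumes "finite S"
  shows "\<exists>q\<in>polys S. \<forall>r\<in>polys S. form K s (p - q) r = 0"
  using assms
proof (induction S arbitrary: p rule: finite_induct)
  case empty
  then show ?case by (auto simp: polys_def)
next
  case (insert v S)
  let ?e = "Poly_Mapping.single v 1 :: 'n cpoly"
  obtain q where q: "q \<in> polys S" "\<And>r. r \<in> polys S \<Longrightarrow> form K s (p - q) r = 0"
    using insert.IH by blast
  obtain f where f: "f \<in> polys S" "\<And>r. r \<in> polys S \<Longrightarrow> form K s (?e - f) r = 0"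
    using insert.IH by blast
  define u where "u = ?e - f"
  define t where "t = form K s (p - q) u / form K s u u"
  define q' where "q' = q + Poly_Mapping.map ((*) t) u"
  have sub: "polys S \<subseteq> polys (insert v S)" using polys_mono by blast
  have u: "u \<in> polys (insert v S)"
    unfolding u_def using f sub by (intro polys_diff polys_single) auto
  have "q' \<in> polys (insert v S)"
    unfolding q'_def using q sub u by (intro polys_add polys_smult) auto
  moreover have "form K s (p - q') r = 0" if r: "r \<in> polys (insert v S)" for r
  proof -
    define c where "c = Poly_Mapping.lookup r v"
    define r' where "r' = r - Poly_Mapping.map ((*) c) u"
    have orth: "form K s (p - q') w = 0" if "w \<in> polys S" for w
      using q(2)[OF that] f(2)[OF that]
      by (simp add: q'_def u_def form_diff_left form_add_left form_smult_left algebra_simps)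
    have "Poly_Mapping.lookup f v = 0"
      using f(1) insert.hyps(2) by (auto simp: polys_def in_keys_iff)
    then have "Poly_Mapping.lookup r' v = 0"
      by (simp add: r'_def u_def c_def lookup_minus)
    moreover have "r' \<in> polys (insert v S)"
      unfolding r'_def using r u by (intro polys_diff polys_smult)
    ultimately have "r' \<in> polys S"
      by (auto simp: polys_def in_keys_iff)
    then have "form K s (p - q') r' = 0" by (rule orth)
    moreover have "form K s (p - q') u = 0"
    proof (cases "form K s u u = 0")
      case True
      then show ?thesis
        using null_vector_orthogonal[OF True] form_hermitian[of K s "p - q'" u] by simp
    next
      case False
      then show ?thesis
        by (simp add: q'_def t_def form_diff_left form_add_left form_smult_left)
    qed
    moreover have "r = r' + Poly_Mapping.map ((*) c) u" by (simp add: r'_def)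
    ultimately show ?thesis
      by (metis form_add_right form_smult_right add_0 mult_zero_right)
  qed
  ultimately show ?case by blast
qed

text \<open>The component \<open>u = p - q\<close> of a vector \<open>p\<close> orthogonal to the domain gives an element \<open>(0, u)\<close> of the
  adjoint. A self-adjoint operator contains it, and being single-valued at \<open>0\<close> it forces \<open>u = 0\<close>.\<close>

lemma self_adjoint_imp_total:
  assumes "self_adjoint_op (hilb K s) (hip K s) (mult_op K s l)"
  shows "cls K s ` polys (shiftable K l) = carrier (hilb K s)"
proof
  show "cls K s ` polys (shiftable K l) \<subseteq> carrier (hilb K s)"
    unfolding carrier_hilb using polys_mono[OF shiftable_subset(1)] by blast
  show "carrier (hilb K s) \<subseteq> cls K s ` polys (shiftable K l)"
  proof
    fix x assume "x \<in> carrier (hilb K s)"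
    then obtain p where p: "p \<in> polys K" "x = cls K s p" by (auto simp: carrier_hilb)
    obtain q where q: "q \<in> polys (shiftable K l)"
      "\<And>r. r \<in> polys (shiftable K l) \<Longrightarrow> form K s (p - q) r = 0"
      using orthogonal_projection_polys[OF finite_shiftable] by blast
    have qK: "q \<in> polys K" using q(1) polys_mono[OF shiftable_subset(1)] by blast
    have "(cls K s 0, cls K s (p - q)) \<in> adjoint_op (hilb K s) (hip K s) (mult_op K s l)"
      unfolding adjoint_op_def
    proof (clarsimp simp: carrier_hilb polys_zero polys_diff p(1) qK)
      fix x w assume xw: "(x, w) \<in> mult_op K s l"
      then obtain r where r: "r \<in> polys (shiftable K l)" "x = cls K s r"
        using Domain_mult_op by blast
      obtain r' where r': "r' \<in> polys K" "w = cls K s r'"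
        using xw mult_op_subset carrier_hilb by blast
      have rK: "r \<in> polys K" using r(1) polys_mono[OF shiftable_subset(1)] by blast
      have "hip K s x (cls K s (p - q)) = 0"
        using q(2)[OF r(1)] form_hermitian[of K s r "p - q"]
        by (simp add: r(2) hip_cls rK polys_diff p(1) qK)
      moreover have "hip K s w (cls K s 0) = 0"
        by (simp add: r' hip_cls polys_zero)
      ultimately show "hip K s w (cls K s 0) = hip K s x (cls K s (p - q))" by simp
    qed
    then have "(cls K s 0, cls K s (p - q)) \<in> mult_op K s l"
      using assms by (simp add: self_adjoint_op_def)
    moreover have "(cls K s 0, cls K s 0) \<in> mult_op K s l"
      using mult_op_memI[of "{}" l] by (simp add: mono_sum_def)
    ultimately have "cls K s (p - q) = cls K s 0"
      using assms by (auto simp: self_adjoint_op_def dest: single_valuedD)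
    then have "cls K s p = cls K s q"
      using p qK by (simp add: cls_eq_iff polys_diff polys_zero form_diff_left)
    then show "x \<in> cls K s ` polys (shiftable K l)"
      using p q(1) by blast
  qed
qed

end

text \<open>A unit shift raises the degree by \<open>1\<close> in every direction, so either all shifts of a multi-index stay
  in a triangular set or none does.\<close>

lemma shiftable_triangular:
  "shiftable (triangular r :: 'n::finite mindex set) l = shiftable_all (triangular r)"
proof -
  have "abs_mi (k + unit_mi m) = Suc (abs_mi k)" for k :: "'n mindex" and m
    by (simp add: abs_mi_def unit_mi_def lookup_add sum.distrib lookup_single when_def)
  then show ?thesis
    by (auto simp: shiftable_def shiftable_all_def triangular_def)
qed

section \<open>From moment matrices to the form\<close>

lemma bij_betw_pick:
  assumes "finite I"
  shows "bij_betw (pick I) {..<card I} I"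
proof (rule bij_betw_imageI)
  show "inj_on (pick I) {..<card I}"
    by (rule inj_on_inverseI[of _ "\<lambda>i. card {a \<in> I. a < i}"]) (simp add: card_pick_le)
  show "pick I ` {..<card I} = I"
  proof
    show "pick I ` {..<card I} \<subseteq> I" by (auto intro: pick_in_set_le)
    show "I \<subseteq> pick I ` {..<card I}"
    proof
      fix i assume i: "i \<in> I"
      have "{a \<in> I. a < i} \<subset> I"
        using i by auto
      then have "card {a \<in> I. a < i} \<in> {..<card I}"
        using psubset_card_mono[OF assms] by simp
      with pick_card_in_set[OF i, symmetric] show "i \<in> pick I ` {..<card I}"
        by (rule image_eqI)
    qed
  qed
qed

text \<open>With \<open>f = k\<close> and with \<open>f\<close> the shift of \<open>k\<close> by a unit multi-index, this describes the kernels of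
  \<open>\<Gamma>\<^sub>l\<close> and of its shifted companion without reference to the enumeration of the index set.\<close>

lemma mat_kernel_submatrix_Gamma:
  assumes "I \<subseteq> {0..\<rho>}"
  shows "vec (card I) (\<lambda>i. x (pick I i)) \<in> mat_kernel (submatrix (Gamma \<rho> f s) I I) \<longleftrightarrow>
    (\<forall>m\<in>I. (\<Sum>j\<in>I. x j * complex_of_real (s (f j + f m))) = 0)"
proof -
  have fin: "finite I" using assms finite_subset by blast
  have I: "{i. i < Suc \<rho> \<and> i \<in> I} = I" using assms by auto
  have pick: "pick I i \<in> I" "pick I i < Suc \<rho>" if "i < card I" for i
    using pick_in_set_le[OF that] assms by auto
  have row: "(submatrix (Gamma \<rho> f s) I I *\<^sub>v vec (card I) (\<lambda>i. x (pick I i))) $ i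
      = (\<Sum>j\<in>I. x j * complex_of_real (s (f j + f (pick I i))))" if "i < card I" for i
  proof -
    have "(submatrix (Gamma \<rho> f s) I I *\<^sub>v vec (card I) (\<lambda>i. x (pick I i))) $ i
        = (\<Sum>j<card I. x (pick I j) * complex_of_real (s (f (pick I j) + f (pick I i))))"
      using that pick by (auto simp: submatrix_def Gamma_def I scalar_prod_def
          atLeast0LessThan mult.commute intro!: sum.cong)
    also have "\<dots> = (\<Sum>j\<in>I. x j * complex_of_real (s (f j + f (pick I i))))"
      by (rule sum.reindex_bij_betw[OF bij_betw_pick[OF fin]])
    finally show ?thesis .
  qed
  have dims: "dim_row (submatrix (Gamma \<rho> f s) I I) = card I"
    "dim_col (submatrix (Gamma \<rho> f s) I I) = card I"
    by (simp_all add: dim_submatrix Gamma_def I)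
  have "vec (card I) (\<lambda>i. x (pick I i)) \<in> mat_kernel (submatrix (Gamma \<rho> f s) I I) \<longleftrightarrow>
      (\<forall>i<card I. (\<Sum>j\<in>I. x j * complex_of_real (s (f j + f (pick I i)))) = 0)"
    unfolding mat_kernel_def by (auto simp: dims row vec_eq_iff simp del: index_mult_mat_vec)
  also have "\<dots> \<longleftrightarrow> (\<forall>m\<in>I. (\<Sum>j\<in>I. x j * complex_of_real (s (f j + f m))) = 0)"
  proof -
    have "(\<forall>m\<in>pick I ` {..<card I}. (\<Sum>j\<in>I. x j * complex_of_real (s (f j + f m))) = 0)
      \<longleftrightarrow> (\<forall>i<card I. (\<Sum>j\<in>I. x j * complex_of_real (s (f j + f (pick I i)))) = 0)"
      by auto
    then show ?thesis
      by (simp only: bij_betw_imp_surj_on[OF bij_betw_pick[OF fin]])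
  qed
  finally show ?thesis .
qed

lemma form_eq_Gamma:
  assumes "bij_betw k {0..\<rho>} K"
  defines "v p \<equiv> vec (Suc \<rho>) (\<lambda>j. Poly_Mapping.lookup p (k j))"
  shows "form K s p p = (Gamma \<rho> k s *\<^sub>v v p) \<bullet>c v p"
proof -
  let ?c = "\<lambda>j. Poly_Mapping.lookup p (k j)"
  have "(Gamma \<rho> k s *\<^sub>v v p) \<bullet>c v p
      = (\<Sum>m<Suc \<rho>. \<Sum>j<Suc \<rho>. ?c j * cnj (?c m) * complex_of_real (s (k j + k m)))"
    by (simp add: Gamma_def v_def scalar_prod_def atLeast0LessThan sum_distrib_left
        sum_distrib_right mult_ac del: sum.lessThan_Suc)
  also have "\<dots> = (\<Sum>j<Suc \<rho>. \<Sum>m<Suc \<rho>. ?c j * cnj (?c m) * complex_of_real (s (k j + k m)))"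
    by (rule sum.swap)
  also have "\<dots> = form K s p p"
    unfolding form_def
    by (simp add: sum.reindex_bij_betw[OF assms(1), symmetric] atLeast0AtMost lessThan_Suc_atMost)
  finally show ?thesis by simp
qed

lemma moment_form_if_pos_semidef:
  assumes "bij_betw k {0..\<rho>} K" "pos_semidef (Gamma \<rho> k s)"
  shows "moment_form K s"
proof
  show "finite K" using assms(1) bij_betw_finite by blast
  show "0 \<le> Re (form K s p p)" for p
    using assms(2) form_eq_Gamma[OF assms(1), of s p]
    by (auto simp: pos_semidef_def Gamma_def less_eq_complex_def)
qed

lemma Gamma_kernel_imp_shifted_sums_zero:
  assumes bij: "bij_betw k {0..\<rho>} K"
    and ker: "mat_kernel (Gamma_sub \<rho> k s l) \<subseteq> mat_kernel (Gamma_hat \<rho> k s l)"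
    and zero: "\<And>b. b \<in> shiftable K l \<Longrightarrow>
      (\<Sum>a\<in>shiftable K l. \<delta> a * complex_of_real (s (a + b))) = 0"
    and b: "b \<in> shiftable K l"
  shows "(\<Sum>a\<in>shiftable K l.
    \<delta> a * complex_of_real (s (a + unit_mi l + (b + unit_mi l)))) = 0"
proof -
  let ?I = "Omega \<rho> k l"
  have I: "?I \<subseteq> {0..\<rho>}" by (auto simp: Omega_def)
  have "k ` ?I = shiftable K l"
    using bij_betw_imp_surj_on[OF bij] by (auto simp: Omega_def shiftable_def)
  then have bijI: "bij_betw k ?I (shiftable K l)"
    using bij I by (auto simp: bij_betw_def intro: inj_on_subset)
  have "(\<Sum>j\<in>?I. \<delta> (k j) * complex_of_real (s (k j + k m))) = 0" if "m \<in> ?I" for m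
    using zero[of "k m"] bij_betwE[OF bijI] that
    by (simp add: sum.reindex_bij_betw[OF bijI, symmetric])
  then have "vec (card ?I) (\<lambda>i. \<delta> (k (pick ?I i))) \<in> mat_kernel (Gamma_sub \<rho> k s l)"
    unfolding Gamma_sub_def using mat_kernel_submatrix_Gamma[OF I, of "\<lambda>j. \<delta> (k j)" k s] by blast
  then have "vec (card ?I) (\<lambda>i. \<delta> (k (pick ?I i))) \<in> mat_kernel (Gamma_hat \<rho> k s l)"
    using ker by blast
  then have shifted: "(\<Sum>j\<in>?I. \<delta> (k j) *
      complex_of_real (s (k j + unit_mi l + (k m + unit_mi l)))) = 0" if "m \<in> ?I" for m
    unfolding Gamma_hat_def
    using mat_kernel_submatrix_Gamma[OF I, of "\<lambda>j. \<delta> (k j)" "\<lambda>j. k j + unit_mi l" s] that by blast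
  obtain m where "m \<in> ?I" "b = k m"
    using b bij_betw_imp_surj_on[OF bijI] by blast
  then show ?thesis
    using shifted by (simp add: sum.reindex_bij_betw[OF bijI, symmetric])
qed

text \<open>Let \<open>\<delta>\<close> be the difference of the coefficients of two preimages with the same class. The polynomial
  with coefficients \<open>\<delta>\<close> is null, hence orthogonal to every \<open>t\<^sup>b\<close> with \<open>b\<close> shiftable, which puts \<open>\<delta>\<close> into
  the kernel of \<open>\<Gamma>\<^sub>l\<close>. By the kernel condition the shifted polynomial is then orthogonal to itself.\<close>

lemma (in moment_form) single_valued_mult_op:
  assumes kernel: "\<And>\<delta> b. (\<And>b. b \<in> shiftable K l \<Longrightarrow>
      (\<Sum>a\<in>shiftable K l. \<delta> a * complex_of_real (s (a + b))) = 0) \<Longrightarrow> b \<in> shiftable K l \<Longrightarrow>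
      (\<Sum>a\<in>shiftable K l. \<delta> a * complex_of_real (s (a + unit_mi l + (b + unit_mi l)))) = 0"
  shows "single_valued (mult_op K s l)"
proof (rule single_valuedI)
  fix x z z' assume "(x, z) \<in> mult_op K s l" "(x, z') \<in> mult_op K s l"
  let ?S = "shiftable K l" and ?t = "\<lambda>a. a + unit_mi l"
  obtain \<alpha> \<beta> where
    x: "x = cls K s (mono_sum ?S (\<lambda>a. a) \<alpha>)" "x = cls K s (mono_sum ?S (\<lambda>a. a) \<beta>)" and
    z: "z = cls K s (mono_sum ?S ?t \<alpha>)" "z' = cls K s (mono_sum ?S ?t \<beta>)"
    using \<open>(x, z) \<in> mult_op K s l\<close> \<open>(x, z') \<in> mult_op K s l\<close> unfolding mult_op_eq by blast
  note sub = shiftable_subset(1,2)[of l]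
  define \<delta> where "\<delta> a = \<alpha> a - \<beta> a" for a
  have diff: "mono_sum ?S g \<delta> = mono_sum ?S g \<alpha> - mono_sum ?S g \<beta>"
    for g :: "'n mindex \<Rightarrow> 'n mindex"
    by (simp add: mono_sum_def \<delta>_def single_diff sum_subtractf)
  have "form K s (mono_sum ?S (\<lambda>a. a) \<alpha>) r = form K s (mono_sum ?S (\<lambda>a. a) \<beta>) r" for r
    using x sub cls_eq_iff[of "mono_sum ?S (\<lambda>a. a) \<alpha>" "mono_sum ?S (\<lambda>a. a) \<beta>"]
    by (simp add: mono_sum_in_polys)
  then have null: "form K s (mono_sum ?S (\<lambda>a. a) \<delta>) r = 0" for r
    by (simp add: diff form_diff_left)
  have "(\<Sum>a\<in>?S. \<delta> a * complex_of_real (s (a + b))) = 0" if "b \<in> ?S" for b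
    using null[of "mono_sum {b} (\<lambda>a. a) (\<lambda>_. 1)"] that sub finite_K
    by (subst (asm) form_mono_sum) auto
  then have shifted: "(\<Sum>a\<in>?S. \<delta> a * complex_of_real (s (?t a + ?t b))) = 0" if "b \<in> ?S" for b
    using kernel that by blast
  have "form K s (mono_sum ?S ?t \<delta>) (mono_sum ?S ?t \<delta>)
      = (\<Sum>b\<in>?S. cnj (\<delta> b) * (\<Sum>a\<in>?S. \<delta> a * complex_of_real (s (?t a + ?t b))))"
    using sub finite_K by (subst form_mono_sum, simp_all add: sum_distrib_left mult_ac) (rule sum.swap)
  also have "\<dots> = 0" using shifted by simp
  finally have "form K s (mono_sum ?S ?t \<delta>) r = 0" for r by (rule null_vector_orthogonal)
  then show "z = z'"
    unfolding z using sub by (simp add: cls_eq_iff mono_sum_in_polys diff form_diff_left)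
qed

section \<open>Dimensional stability and complete self-adjointness\<close>

theorem theorem1:
  fixes K :: "'n::finite mindex set"
    and s :: "'n mindex \<Rightarrow> real"
    and \<rho> :: nat
    and k :: "nat \<Rightarrow> 'n mindex"
  assumes "admissible K"
    and "bij_betw k {0..\<rho>} K"
    and "pos_semidef (Gamma \<rho> k s)"
    and "\<And>l. mat_kernel (Gamma_sub \<rho> k s l) \<subseteq> mat_kernel (Gamma_hat \<rho> k s l)"
  shows "(dimensionally_stable K s \<longrightarrow> completely_self_adjoint K s) \<and>
    (\<forall>r. K = triangular r \<longrightarrow> completely_self_adjoint K s \<longrightarrow> dimensionally_stable K s)"
proof -
  interpret moment_form K s
    using assms(2,3) by (rule moment_form_if_pos_semidef)
  have single: "single_valued (mult_op K s l)" for l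
    using Gamma_kernel_imp_shifted_sums_zero[OF assms(2,4)] by (rule single_valued_mult_op)
  have "completely_self_adjoint K s" if "dimensionally_stable K s"
    using dimensionally_stable_imp_H0_full[OF that] single
    by (rule H0_full_imp_completely_self_adjoint)
  moreover have "dimensionally_stable K s"
    if K: "K = triangular r" and csa: "completely_self_adjoint K s" for r
  proof -
    have "self_adjoint_op (hilb K s) (hip K s) (mult_op K s l)" for l
      using csa by (simp add: completely_self_adjoint_def)
    then have "H0 K s = carrier (hilb K s)"
      using self_adjoint_imp_total shiftable_triangular[of r] by (metis H0_eq K)
    then show ?thesis
      by (simp add: dimensionally_stable_def)
  qed
  ultimately show ?thesis by blast
qed

end
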